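(* Let $N$ and $H$ be finite groups, let $\varphi: H\to \mathrm{Aut}(N)$ be a homomorphism, and let $G=N\rtimes_\varphi H$. Let $D>0$ and suppose $G$ is $D$-quasirandom on $N$. For $g=(z,h)\in G$ write $\dot g=h$. For any integer $k\ge 2$ and subsets $X_1,\ldots,X_k\subseteq G$, let \[ \dot{\mathcal{N}}_k=\#\{(x_1,\ldots,x_k,y_1,\ldots,y_k)\in (X_1\times\cdots\times X_k)^2:\ \dot{x_1}\dot{x_2}\cdots\dot{x_k}=\dot{y_1}\dot{y_2}\cdots\dot{y_k}\}. \] Then \[ \frac{|H|\dot{\mathcal{N}}_k}{|G|^{2k}}\le \|1_{X_1}\ast 1_{X_2}\ast\cdots\ast 1_{X_k}\|_2^2\le \frac{|H|\dot{\mathcal{N}}_k}{|G|^{2k}}+\frac{|X_1||X_2|\cdots|X_k|}{D^{k-1}|G|^k}. \]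
   Context: $G=N\rtimes_\varphi H$ is $\{(z,h):z\in N,h\in H\}$ with $(z_1,h_1)(z_2,h_2)=(z_1\varphi(h_1)(z_2),h_1h_2)$. A complex representation $\rho$ of $G$ is of type II if $\rho((z,1_H))$ is not the identity for some $z\in N$; $G$ is $D$-quasirandom on $N$ if every type II complex representation of $G$ has degree at least $D$. $1_X$ is the indicator function of $X$. Convolution is normalized: $(f_1\ast f_2)(x)=\frac{1}{|G|}\sum_{y\in G}f_1(xy^{-1})f_2(y)$, and $\|f\|_2^2=\frac{1}{|G|}\sum_{x\in G}|f(x)|^2$. *)

theory Defs
  imports
    "HOL-Algebra.Bij"
    "HOL-Library.Indicator_Function"
    "Jordan_Normal_Form.Matrix"
begin

definition semidirect ::
  "('n, 'p) monoid_scheme \<Rightarrow> ('h, 'q) monoid_scheme \<Rightarrow> ('h \<Rightarrow> 'n \<Rightarrow> 'n) \<Rightarrow> ('n \<times> 'h) monoid"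
  where
  "semidirect N H \<phi> =
    \<lparr>carrier = carrier N \<times> carrier H,
     monoid.mult = (\<lambda>(z1, h1) (z2, h2). (z1 \<otimes>\<^bsub>N\<^esub> \<phi> h1 z2, h1 \<otimes>\<^bsub>H\<^esub> h2)),
     one = (\<one>\<^bsub>N\<^esub>, \<one>\<^bsub>H\<^esub>)\<rparr>"

lemma carrier_semidirect [simp]: "carrier (semidirect N H \<phi>) = carrier N \<times> carrier H"
  by (simp add: semidirect_def)

lemma mult_semidirect [simp]:
  "(z1, h1) \<otimes>\<^bsub>semidirect N H \<phi>\<^esub> (z2, h2) = (z1 \<otimes>\<^bsub>N\<^esub> \<phi> h1 z2, h1 \<otimes>\<^bsub>H\<^esub> h2)"
  by (simp add: semidirect_def)

lemma one_semidirect [simp]: "\<one>\<^bsub>semidirect N H \<phi>\<^esub> = (\<one>\<^bsub>N\<^esub>, \<one>\<^bsub>H\<^esub>)"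
  by (simp add: semidirect_def)

lemma group_semidirect:
  assumes "group N" "group H" and \<phi>: "\<phi> \<in> hom H (AutoGroup N)"
  shows "group (semidirect N H \<phi>)"
proof -
  interpret N: group N by fact
  interpret H: group H by fact
  have aut: "\<phi> h \<in> auto N" if "h \<in> carrier H" for h
    using that \<phi> by (auto simp: hom_def AutoGroup_def)
  have cl: "\<phi> h z \<in> carrier N" if "h \<in> carrier H" "z \<in> carrier N" for h z
    using aut[OF that(1)] that by (auto simp: auto_def hom_def)
  have mul: "\<phi> h (z1 \<otimes>\<^bsub>N\<^esub> z2) = \<phi> h z1 \<otimes>\<^bsub>N\<^esub> \<phi> h z2"
    if "h \<in> carrier H" "z1 \<in> carrier N" "z2 \<in> carrier N" for h z1 z2
    using aut[OF that(1)] that by (auto simp: auto_def hom_def)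
  have comp: "\<phi> (h1 \<otimes>\<^bsub>H\<^esub> h2) z = \<phi> h1 (\<phi> h2 z)"
    if "h1 \<in> carrier H" "h2 \<in> carrier H" "z \<in> carrier N" for h1 h2 z
    using aut[OF that(1)] aut[OF that(2)] that \<phi>
    by (auto simp: hom_def AutoGroup_def BijGroup_def auto_def compose_def)
  have one: "\<phi> \<one>\<^bsub>H\<^esub> z = z" if "z \<in> carrier N" for z
  proof -
    have "inj_on (\<phi> \<one>\<^bsub>H\<^esub>) (carrier N)"
      using aut[of "\<one>\<^bsub>H\<^esub>"] by (auto simp: auto_def Bij_def bij_betw_def)
    moreover have "\<phi> \<one>\<^bsub>H\<^esub> (\<phi> \<one>\<^bsub>H\<^esub> z) = \<phi> \<one>\<^bsub>H\<^esub> z"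
      using comp[of "\<one>\<^bsub>H\<^esub>" "\<one>\<^bsub>H\<^esub>" z] that by simp
    ultimately show ?thesis using that cl by (auto dest: inj_onD)
  qed
  show ?thesis
  proof (rule groupI)
    fix x assume x: "x \<in> carrier (semidirect N H \<phi>)"
    obtain z h where [simp]: "x = (z, h)" by (cases x)
    from x have zh: "z \<in> carrier N" "h \<in> carrier H" by auto
    show "\<exists>y\<in>carrier (semidirect N H \<phi>). y \<otimes>\<^bsub>semidirect N H \<phi>\<^esub> x = \<one>\<^bsub>semidirect N H \<phi>\<^esub>"
      by (rule bexI[of _ "(inv\<^bsub>N\<^esub> (\<phi> (inv\<^bsub>H\<^esub> h) z), inv\<^bsub>H\<^esub> h)"]) (use zh cl in auto)
  qed (auto simp: cl mul comp one N.m_assoc H.m_assoc)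
qed

abbreviation GL :: "nat \<Rightarrow> complex mat monoid"
  where "GL n \<equiv> units_of (ring_mat TYPE(complex) n ())"

definition complex_representation :: "('g, 'p) monoid_scheme \<Rightarrow> nat \<Rightarrow> ('g \<Rightarrow> complex mat) \<Rightarrow> bool"
  where "complex_representation G n \<rho> \<longleftrightarrow> \<rho> \<in> hom G (GL n)"

definition type_II ::
  "('n, 'p) monoid_scheme \<Rightarrow> ('h, 'q) monoid_scheme \<Rightarrow> nat \<Rightarrow> ('n \<times> 'h \<Rightarrow> complex mat) \<Rightarrow> bool"
  where "type_II N H n \<rho> \<longleftrightarrow> (\<exists>z\<in>carrier N. \<rho> (z, \<one>\<^bsub>H\<^esub>) \<noteq> 1\<^sub>m n)"

definition quasirandom_on ::
  "real \<Rightarrow> ('n, 'p) monoid_scheme \<Rightarrow> ('h, 'q) monoid_scheme \<Rightarrow> ('h \<Rightarrow> 'n \<Rightarrow> 'n) \<Rightarrow> bool"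
  where
  "quasirandom_on D N H \<phi> \<longleftrightarrow>
    (\<forall>n \<rho>. complex_representation (semidirect N H \<phi>) n \<rho> \<and> type_II N H n \<rho> \<longrightarrow> D \<le> real n)"

definition convolution ::
  "('g, 'p) monoid_scheme \<Rightarrow> ('g \<Rightarrow> complex) \<Rightarrow> ('g \<Rightarrow> complex) \<Rightarrow> 'g \<Rightarrow> complex"
  where
  "convolution G f1 f2 x =
    (\<Sum>y\<in>carrier G. f1 (x \<otimes>\<^bsub>G\<^esub> inv\<^bsub>G\<^esub> y) * f2 y) / of_nat (card (carrier G))"

text \<open>Iterated convolution of a nonempty list of functions, associated to the left.\<close>

definition convolutions ::
  "('g, 'p) monoid_scheme \<Rightarrow> ('g \<Rightarrow> complex) list \<Rightarrow> 'g \<Rightarrow> complex"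
  where "convolutions G fs = foldl (convolution G) (hd fs) (tl fs)"

definition norm_2 :: "('g, 'p) monoid_scheme \<Rightarrow> ('g \<Rightarrow> complex) \<Rightarrow> real"
  where "norm_2 G f = sqrt ((\<Sum>x\<in>carrier G. (cmod (f x))\<^sup>2) / real (card (carrier G)))"

definition list_mult :: "('g, 'p) monoid_scheme \<Rightarrow> 'g list \<Rightarrow> 'g"
  where "list_mult G xs = foldr (\<otimes>\<^bsub>G\<^esub>) xs \<one>\<^bsub>G\<^esub>"

text \<open>A list \<open>Xs = [X1, \<dots>, Xk]\<close> of sets encodes the \<open>k\<close>-tuple of sets, and \<open>listset Xs\<close> is the
  product \<open>X1 \<times> \<dots> \<times> Xk\<close>.\<close>

definition dot_count :: "('h, 'q) monoid_scheme \<Rightarrow> ('n \<times> 'h) set list \<Rightarrow> nat"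
  where
  "dot_count H Xs =
    card {(xs, ys). xs \<in> listset Xs \<and> ys \<in> listset Xs \<and>
      list_mult H (map snd xs) = list_mult H (map snd ys)}"

end

theory Submission
  imports Defs "HOL-Algebra.Coset" "HOL-Analysis.Function_Topology" "HOL-Analysis.Topology_Euclidean_Space"
begin

text \<open>
  Averaging over the cosets of \<open>K = N \<times> 1\<close> is an orthogonal projection \<open>P\<close> with
  \<open>P (f * g) = P f * g\<close>. Applied to \<open>F = 1\<^sub>X\<^sub>1 * \<dots> * 1\<^sub>X\<^sub>k\<close>, the norm of \<open>P F\<close> is exactly the counting
  term, and \<open>F - P F = (1\<^sub>X\<^sub>1 - P 1\<^sub>X\<^sub>1) * 1\<^sub>X\<^sub>2 * \<dots> * 1\<^sub>X\<^sub>k\<close> is bounded by \<open>k - 1\<close> applications of the mixing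
  inequality \<open>D \<parallel>f * g\<parallel>\<^sup>2 \<le> \<parallel>f\<parallel>\<^sup>2 \<parallel>g\<parallel>\<^sup>2\<close> for \<open>P f = 0\<close>. For the latter, let \<open>\<mu>\<close> be the largest value of
  \<open>\<parallel>f * g\<parallel>\<^sup>2\<close> over unit vectors \<open>g\<close>. If \<open>\<mu> > 0\<close>, the space on which \<open>\<parallel>f * g\<parallel>\<^sup>2 = \<mu> \<parallel>g\<parallel>\<^sup>2\<close> is invariant
  under right translation and contains no nonzero \<open>K\<close>-invariant function, so it is a
  representation nontrivial on \<open>K\<close> and has dimension at least \<open>D\<close>; by Bessel's inequality \<open>D \<mu>\<close>
  is at most the squared Hilbert-Schmidt norm of the operator, which is \<open>\<parallel>f\<parallel>\<^sup>2\<close>.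
\<close>

section \<open>Operators on functions on a finite set\<close>

text \<open>Sums are left unnormalised: over \<open>carrier G\<close>, dividing by the group order
  gives the square of \<open>norm_2\<close>.\<close>

definition sq_sum :: "'a set \<Rightarrow> ('a \<Rightarrow> complex) \<Rightarrow> real"
  where "sq_sum A f = (\<Sum>x\<in>A. (cmod (f x))\<^sup>2)"

definition inner_on :: "'a set \<Rightarrow> ('a \<Rightarrow> complex) \<Rightarrow> ('a \<Rightarrow> complex) \<Rightarrow> complex"
  where "inner_on A f g = (\<Sum>x\<in>A. f x * cnj (g x))"

text \<open>With \<open>K x y = f (x \<otimes> inv y)\<close> on a group this is the map
  \<open>g\<close> to \<open>f * g\<close> without the division by the group order.\<close>

definition kernel_op :: "'a set \<Rightarrow> ('a \<Rightarrow> 'a \<Rightarrow> complex) \<Rightarrow> ('a \<Rightarrow> complex) \<Rightarrow> 'a \<Rightarrow> complex"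
  where "kernel_op A K g x = (\<Sum>y\<in>A. K x y * g y)"

lemma sq_sum_nonneg [simp]: "0 \<le> sq_sum A f"
  by (simp add: sq_sum_def sum_nonneg)

lemma sq_sum_cong: "(\<And>x. x \<in> A \<Longrightarrow> f x = g x) \<Longrightarrow> sq_sum A f = sq_sum A g"
  by (simp add: sq_sum_def)

lemma sq_sum_scale: "sq_sum A (\<lambda>x. c * f x) = (cmod c)\<^sup>2 * sq_sum A f"
  by (simp add: sq_sum_def norm_mult power_mult_distrib sum_distrib_left)

lemma sq_sum_eq_0_iff: "finite A \<Longrightarrow> sq_sum A f = 0 \<longleftrightarrow> (\<forall>x\<in>A. f x = 0)"
  by (simp add: sq_sum_def sum_nonneg_eq_0_iff)

lemma inner_on_self: "inner_on A f f = of_real (sq_sum A f)"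
  by (simp add: inner_on_def sq_sum_def complex_norm_square del: of_real_power)

lemma inner_on_cong:
  "(\<And>x. x \<in> A \<Longrightarrow> f x = f' x) \<Longrightarrow> (\<And>x. x \<in> A \<Longrightarrow> g x = g' x) \<Longrightarrow>
    inner_on A f g = inner_on A f' g'"
  by (simp add: inner_on_def)

lemma inner_on_cnj: "cnj (inner_on A f g) = inner_on A g f"
  by (simp add: inner_on_def mult.commute)

lemma inner_on_linear:
  "inner_on A (\<lambda>x. f x + g x) h = inner_on A f h + inner_on A g h"
  "inner_on A (\<lambda>x. f x - g x) h = inner_on A f h - inner_on A g h"
  "inner_on A (\<lambda>x. c * f x) h = c * inner_on A f h"
  "inner_on A (\<lambda>x. \<Sum>i\<in>I. F i x) h = (\<Sum>i\<in>I. inner_on A (F i) h)"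
  by (simp_all add: inner_on_def sum.distrib sum_subtractf algebra_simps sum_distrib_left
      sum_distrib_right sum.swap[of _ A])

lemma inner_on_antilinear:
  "inner_on A h (\<lambda>x. f x + g x) = inner_on A h f + inner_on A h g"
  "inner_on A h (\<lambda>x. f x - g x) = inner_on A h f - inner_on A h g"
  "inner_on A h (\<lambda>x. c * f x) = cnj c * inner_on A h f"
  "inner_on A h (\<lambda>x. \<Sum>i\<in>I. F i x) = (\<Sum>i\<in>I. inner_on A h (F i))"
  by (simp_all add: inner_on_def sum.distrib sum_subtractf algebra_simps sum_distrib_left
      sum_distrib_right sum.swap[of _ A])

lemma kernel_op_linear:
  "kernel_op A K (\<lambda>x. f x + g x) = (\<lambda>x. kernel_op A K f x + kernel_op A K g x)"
  "kernel_op A K (\<lambda>x. f x - g x) = (\<lambda>x. kernel_op A K f x - kernel_op A K g x)"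
  "kernel_op A K (\<lambda>x. c * f x) = (\<lambda>x. c * kernel_op A K f x)"
  "kernel_op A K (\<lambda>x. \<Sum>i\<in>I. F i x) = (\<lambda>x. \<Sum>i\<in>I. kernel_op A K (F i) x)"
  by (simp_all add: fun_eq_iff kernel_op_def sum.distrib sum_subtractf algebra_simps
      sum_distrib_left sum_distrib_right sum.swap[of _ A])

lemma kernel_op_cong: "(\<And>x. x \<in> A \<Longrightarrow> f x = g x) \<Longrightarrow> kernel_op A K f = kernel_op A K g"
  by (simp add: kernel_op_def fun_eq_iff)

text \<open>Expansion of the square; it serves both the first-order variation at a maximiser and
  Pythagoras for coset averages.\<close>

lemma sq_sum_add_scale:
  "sq_sum A (\<lambda>x. f x + c * g x) =
     sq_sum A f + 2 * Re (cnj c * inner_on A f g) + (cmod c)\<^sup>2 * sq_sum A g"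
proof -
  have "complex_of_real (sq_sum A (\<lambda>x. f x + c * g x)) =
      inner_on A f f + (cnj c * inner_on A f g + cnj (cnj c * inner_on A f g)) +
      c * cnj c * inner_on A g g"
    by (simp add: inner_on_self[symmetric] inner_on_linear inner_on_antilinear inner_on_cnj
        algebra_simps)
  also have "\<dots> = of_real (sq_sum A f + 2 * Re (cnj c * inner_on A f g) + (cmod c)\<^sup>2 * sq_sum A g)"
    by (simp only: complex_add_cnj inner_on_self complex_norm_square[symmetric] of_real_add of_real_mult)
  finally show ?thesis
    by (simp only: of_real_eq_iff)
qed

text \<open>The unit sphere of a finite-dimensional space is compact, so the squared norm of the
  image attains its maximum on it; homogeneity extends the bound to all \<open>g\<close>.\<close>

lemma kernel_op_top_vector:
  assumes A: "finite A" "A \<noteq> {}"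
  obtains v where "sq_sum A v = 1"
    "\<And>g. sq_sum A (kernel_op A K g) \<le> sq_sum A (kernel_op A K v) * sq_sum A g"
proof -
  \<comment> \<open>Values outside \<open>A\<close> are frozen at \<open>undefined\<close>, since
    the sphere would otherwise contain unbounded directions. Coordinates of a unit vector have
    modulus at most 1, so the balls lose none of them.\<close>
  define S where "S = (PiE A (\<lambda>_. cball (0::complex) 1)) \<inter> (sq_sum A -` {1})"
  have cont_coord: "continuous_on UNIV (\<lambda>g::'a \<Rightarrow> complex. g x)" for x
    by (rule continuous_on_product_coordinates)
  have cont: "continuous_on UNIV (sq_sum A)"
    unfolding sq_sum_def by (intro continuous_intros cont_coord)
  have contK: "continuous_on UNIV (\<lambda>g. sq_sum A (kernel_op A K g))"
    unfolding sq_sum_def kernel_op_def by (intro continuous_intros cont_coord)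
  \<comment> \<open>Tychonoff over the whole type: coordinates outside \<open>A\<close> range over a
    compact singleton.\<close>
  have "compact (PiE UNIV (\<lambda>x. if x \<in> A then cball (0::complex) 1 else {undefined}))"
    unfolding compactin_euclidean_iff[symmetric] euclidean_product_topology[symmetric] compactin_PiE
    by (simp add: compactin_euclidean_iff compact_cball)
  moreover have "PiE UNIV (\<lambda>x. if x \<in> A then cball (0::complex) 1 else {undefined}) =
      PiE A (\<lambda>_. cball 0 1)"
    by (fastforce simp: PiE_iff extensional_def split: if_splits)
  ultimately have "compact (PiE A (\<lambda>_. cball (0::complex) 1))"
    by simp
  moreover have "closed (sq_sum A -` {1})"
    using cont by (intro closed_vimage) auto
  ultimately have "compact S"
    unfolding S_def by (rule compact_Int_closed)
  moreover obtain a where a: "a \<in> A" using A by blast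
  have "(\<lambda>x. if x \<in> A then (if x = a then 1 else 0) else undefined) \<in> S"
    using a A by (auto simp: S_def sq_sum_def if_distrib[of cmod] if_distrib[of "\<lambda>t. t\<^sup>2"] split: if_splits cong: if_cong)
  then have "S \<noteq> {}" by blast
  ultimately obtain v where v: "v \<in> S"
    "\<And>g. g \<in> S \<Longrightarrow> sq_sum A (kernel_op A K g) \<le> sq_sum A (kernel_op A K v)"
    using continuous_attains_sup[OF _ _ continuous_on_subset[OF contK]] by (metis subset_UNIV)
  show ?thesis
  proof
    show "sq_sum A v = 1" using v by (simp add: S_def)
    fix g
    show "sq_sum A (kernel_op A K g) \<le> sq_sum A (kernel_op A K v) * sq_sum A g"
    proof (cases "sq_sum A g = 0")
      case True
      then have "\<forall>x\<in>A. g x = 0" using A by (simp add: sq_sum_eq_0_iff)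
      then show ?thesis by (simp add: True kernel_op_def sq_sum_def)
    next
      case False
      then have pos: "sq_sum A g > 0" using sq_sum_nonneg[of A g] by linarith
      define c where "c = complex_of_real (1 / sqrt (sq_sum A g))"
      have c: "(cmod c)\<^sup>2 = 1 / sq_sum A g"
        using pos by (simp add: c_def power_divide norm_divide)
      define w where "w = restrict (\<lambda>x. c * g x) A"
      have w1: "sq_sum A w = 1"
        using pos sq_sum_cong[of A w "\<lambda>x. c * g x"] by (simp add: w_def sq_sum_scale c)
      have "cmod (w x) \<le> 1" if "x \<in> A" for x
      proof -
        have "(cmod (w x))\<^sup>2 \<le> sq_sum A w"
          unfolding sq_sum_def using that A by (intro member_le_sum) auto
        then show ?thesis using w1 by (simp add: power_le_one_iff abs_square_le_1)
      qed
      then have "w \<in> S" using w1 by (auto simp: S_def w_def)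
      then have "sq_sum A (kernel_op A K w) \<le> sq_sum A (kernel_op A K v)" by (rule v)
      moreover have "kernel_op A K w = (\<lambda>x. c * kernel_op A K g x)"
        using kernel_op_cong[of A w "\<lambda>x. c * g x"] by (simp add: w_def kernel_op_linear)
      ultimately show ?thesis using pos by (simp add: sq_sum_scale c field_simps)
    qed
  qed
qed

text \<open>Where the bound is attained, the first-order variation in every direction
  \<open>u\<close> vanishes. The result is the weak form of the eigenvector equation for the
  operator followed by its adjoint.\<close>

lemma kernel_op_critical:
  assumes le: "\<And>g. sq_sum A (kernel_op A K g) \<le> \<mu> * sq_sum A g"
    and eq: "sq_sum A (kernel_op A K v) = \<mu> * sq_sum A v"
  shows "inner_on A (kernel_op A K v) (kernel_op A K u) = \<mu> * inner_on A v u"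
proof -
  define b where "b = \<mu> * inner_on A v u - inner_on A (kernel_op A K v) (kernel_op A K u)"
  define q where "q = \<mu> * sq_sum A u - sq_sum A (kernel_op A K u)"
  (* The perturbation v - s b u, with s small enough for its linear term to dominate, forces b = 0. *)
  define s where "s = 1 / (q + 1)"
  have q: "q \<ge> 0" using le[of u] by (simp add: q_def)
  have key: "0 \<le> 2 * Re (cnj c * b) + (cmod c)\<^sup>2 * q" for c
    using le[of "\<lambda>x. v x + c * u x"] eq
    by (simp add: kernel_op_linear sq_sum_add_scale b_def q_def algebra_simps)
  have "Re (cnj (- s * b) * b) = - s * (cmod b)\<^sup>2"
    by (simp add: cmod_def power2_eq_square algebra_simps)
  then have "0 \<le> - (2 * s * (cmod b)\<^sup>2) + s\<^sup>2 * (cmod b)\<^sup>2 * q"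
    using key[of "- s * b"] by (simp add: norm_mult power_mult_distrib)
  also have "\<dots> = - (s * (cmod b)\<^sup>2 * (2 - s * q))"
    by (simp add: power2_eq_square algebra_simps)
  finally have "s * (cmod b)\<^sup>2 * (2 - s * q) \<le> 0" by simp
  moreover have "s > 0" "2 - s * q > 0" using q by (simp_all add: s_def field_simps)
  ultimately have "(cmod b)\<^sup>2 \<le> 0"
    by (metis mult_le_0_iff mult.commute not_less order_less_le zero_less_mult_iff linorder_not_le)
  then show ?thesis by (simp add: b_def)
qed

section \<open>Orthonormal families and the space of maximisers\<close>

definition orthonormal_on :: "'a set \<Rightarrow> nat \<Rightarrow> (nat \<Rightarrow> 'a \<Rightarrow> complex) \<Rightarrow> bool"
  where "orthonormal_on A n v \<longleftrightarrow>
    (\<forall>i<n. \<forall>j<n. inner_on A (v i) (v j) = (if i = j then 1 else 0))"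

definition proj_on :: "'a set \<Rightarrow> nat \<Rightarrow> (nat \<Rightarrow> 'a \<Rightarrow> complex) \<Rightarrow> ('a \<Rightarrow> complex) \<Rightarrow> 'a \<Rightarrow> complex"
  where "proj_on A n v g x = (\<Sum>i<n. inner_on A g (v i) * v i x)"

lemma inner_on_proj_on:
  assumes "orthonormal_on A n v" "j < n"
  shows "inner_on A (proj_on A n v g) (v j) = inner_on A g (v j)"
proof -
  have "inner_on A (proj_on A n v g) (v j) = (\<Sum>i<n. inner_on A g (v i) * inner_on A (v i) (v j))"
    by (simp add: proj_on_def[abs_def] inner_on_linear)
  also have "\<dots> = (\<Sum>i<n. if i = j then inner_on A g (v i) else 0)"
    using assms by (intro sum.cong) (auto simp: orthonormal_on_def)
  also have "\<dots> = inner_on A g (v j)" using assms by simp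
  finally show ?thesis .
qed

text \<open>The residual of \<open>g\<close> is orthogonal to its projection, so the difference of
  the two sides is the squared norm of the residual.\<close>

lemma bessel_inequality:
  assumes "orthonormal_on A n v"
  shows "(\<Sum>i<n. (cmod (inner_on A g (v i)))\<^sup>2) \<le> sq_sum A g"
proof -
  let ?p = "proj_on A n v g"
  have ip: "inner_on A h ?p = (\<Sum>i<n. cnj (inner_on A g (v i)) * inner_on A h (v i))" for h
    by (simp add: proj_on_def[abs_def] inner_on_antilinear)
  have "inner_on A (\<lambda>x. g x - ?p x) ?p = 0"
    using assms by (subst ip) (auto simp: inner_on_linear inner_on_proj_on)
  then have "inner_on A g ?p = inner_on A ?p ?p" by (simp add: inner_on_linear)
  moreover from this have "inner_on A ?p g = inner_on A ?p ?p"
    by (metis inner_on_cnj)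
  ultimately have "inner_on A (\<lambda>x. g x - ?p x) (\<lambda>x. g x - ?p x) = inner_on A g g - inner_on A g ?p"
    by (simp add: inner_on_linear inner_on_antilinear)
  moreover have "inner_on A g ?p = of_real (\<Sum>i<n. (cmod (inner_on A g (v i)))\<^sup>2)"
    by (simp add: ip complex_norm_square mult.commute del: of_real_power)
  ultimately have "sq_sum A (\<lambda>x. g x - ?p x) = sq_sum A g - (\<Sum>i<n. (cmod (inner_on A g (v i)))\<^sup>2)"
    by (simp only: inner_on_self of_real_diff[symmetric] of_real_eq_iff)
  then show ?thesis using sq_sum_nonneg[of A "\<lambda>x. g x - ?p x"] by linarith
qed

text \<open>Up to conjugation, the image of \<open>v i\<close> at \<open>x\<close> is the inner
  product of the conjugated row \<open>K x\<close> with \<open>v i\<close>. Bessel for each row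
  gives the bound by the squared Hilbert-Schmidt norm.\<close>

lemma sum_sq_sum_kernel_op_le:
  assumes "orthonormal_on A n v"
  shows "(\<Sum>i<n. sq_sum A (kernel_op A K (v i))) \<le> (\<Sum>x\<in>A. sq_sum A (K x))"
proof -
  have "cmod (kernel_op A K (v i) x) = cmod (inner_on A (\<lambda>y. cnj (K x y)) (v i))" for i x
  proof -
    have "cnj (kernel_op A K (v i) x) = inner_on A (\<lambda>y. cnj (K x y)) (v i)"
      by (simp add: kernel_op_def inner_on_def)
    then show ?thesis by (metis complex_mod_cnj)
  qed
  then have "(\<Sum>i<n. sq_sum A (kernel_op A K (v i))) =
      (\<Sum>x\<in>A. \<Sum>i<n. (cmod (inner_on A (\<lambda>y. cnj (K x y)) (v i)))\<^sup>2)"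
    unfolding sq_sum_def by (simp add: sum.swap[of _ A])
  also have "\<dots> \<le> (\<Sum>x\<in>A. sq_sum A (\<lambda>y. cnj (K x y)))"
    by (intro sum_mono bessel_inequality assms)
  finally show ?thesis by (simp add: sq_sum_def)
qed

text \<open>The vectors attaining the bound form a linear space, and orthonormal families in it have
  size at most the squared Hilbert-Schmidt norm divided by \<open>\<mu>\<close>. A family of largest
  size exists and must span.\<close>

lemma top_space_basis:
  assumes A: "finite A" and pos: "\<mu> > 0"
    and le: "\<And>g. sq_sum A (kernel_op A K g) \<le> \<mu> * sq_sum A g"
  obtains n v where "orthonormal_on A n v" "n * \<mu> \<le> (\<Sum>x\<in>A. sq_sum A (K x))"
    "\<And>i. i < n \<Longrightarrow> sq_sum A (kernel_op A K (v i)) = \<mu>"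
    "\<And>w x. sq_sum A (kernel_op A K w) = \<mu> * sq_sum A w \<Longrightarrow> x \<in> A \<Longrightarrow> w x = proj_on A n v w x"
proof -
  define V where "V g \<longleftrightarrow> sq_sum A (kernel_op A K g) = \<mu> * sq_sum A g" for g
  define P where "P n \<longleftrightarrow> (\<exists>v. orthonormal_on A n v \<and> (\<forall>i<n. V (v i)))" for n
  \<comment> \<open>Criticality replaces the quadratic condition by equations linear in
    \<open>g\<close>, so \<open>V\<close> is closed under linear combinations.\<close>
  have V_iff: "V g \<longleftrightarrow> (\<forall>u. inner_on A (kernel_op A K g) (kernel_op A K u) = \<mu> * inner_on A g u)" for g
  proof
    assume "V g"
    then show "\<forall>u. inner_on A (kernel_op A K g) (kernel_op A K u) = \<mu> * inner_on A g u"
      using kernel_op_critical[OF le] by (simp add: V_def)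
  next
    assume "\<forall>u. inner_on A (kernel_op A K g) (kernel_op A K u) = \<mu> * inner_on A g u"
    then have "inner_on A (kernel_op A K g) (kernel_op A K g) = \<mu> * inner_on A g g" by blast
    then show "V g"
      unfolding V_def by (simp only: inner_on_self of_real_mult[symmetric] of_real_eq_iff)
  qed
  have self: "sq_sum A (v i) = 1" if "orthonormal_on A n v" "i < n" for n v i
  proof -
    have "inner_on A (v i) (v i) = 1" using that by (simp add: orthonormal_on_def)
    then show ?thesis by (simp add: inner_on_self)
  qed
  have bound: "n * \<mu> \<le> (\<Sum>x\<in>A. sq_sum A (K x))"
    if "orthonormal_on A n v" "\<forall>i<n. V (v i)" for n v
  proof -
    have "n * \<mu> = (\<Sum>i<n. sq_sum A (kernel_op A K (v i)))"
      using that self[OF that(1)] by (simp add: V_def)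
    then show ?thesis using sum_sq_sum_kernel_op_le[OF that(1), of K] by simp
  qed
  have "P 0" by (simp add: P_def orthonormal_on_def)
  moreover have "n \<le> nat \<lfloor>(\<Sum>x\<in>A. sq_sum A (K x)) / \<mu>\<rfloor>" if "P n" for n
    using that pos bound by (intro le_nat_floor) (auto simp: P_def field_simps)
  ultimately obtain n where n: "P n" "\<And>m. P m \<Longrightarrow> m \<le> n"
    using Nat.ex_has_greatest_nat[of P 0 _] by (metis (no_types))
  then obtain v where v: "orthonormal_on A n v" "\<forall>i<n. V (v i)" by (auto simp: P_def)
  \<comment> \<open>Otherwise the normalised residual of \<open>w\<close> could be appended to
    \<open>v\<close>, against the maximality of \<open>n\<close>.\<close>
  have complete: "w x = proj_on A n v w x" if "V w" "x \<in> A" for w x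
  proof (rule ccontr)
    define r where "r = (\<lambda>x. w x - proj_on A n v w x)"
    assume "w x \<noteq> proj_on A n v w x"
    then have "sq_sum A r \<noteq> 0" using that A by (auto simp: sq_sum_eq_0_iff r_def)
    then have rpos: "sq_sum A r > 0" using sq_sum_nonneg[of A r] by linarith
    define c where "c = complex_of_real (1 / sqrt (sq_sum A r))"
    have c: "(cmod c)\<^sup>2 = 1 / sq_sum A r"
      using rpos by (simp add: c_def power_divide norm_divide)
    define v' where "v' = v(n := \<lambda>x. c * r x)"
    have "V (\<lambda>x. c * r x)"
      using v \<open>V w\<close> unfolding V_iff r_def proj_on_def[abs_def]
      by (simp add: kernel_op_linear inner_on_linear) (simp add: algebra_simps sum_distrib_left)
    then have "\<forall>i<Suc n. V (v' i)" using v by (simp add: v'_def less_Suc_eq)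
    moreover have "orthonormal_on A (Suc n) v'"
    proof -
      have orth: "inner_on A (\<lambda>x. c * r x) (v j) = 0" if "j < n" for j
        using that v by (simp add: r_def inner_on_linear inner_on_proj_on)
      then have orth': "inner_on A (v j) (\<lambda>x. c * r x) = 0" if "j < n" for j
        using that by (metis inner_on_cnj complex_cnj_zero)
      have "inner_on A (\<lambda>x. c * r x) (\<lambda>x. c * r x) = 1"
        using rpos by (simp add: inner_on_self sq_sum_scale c)
      then show ?thesis
        using v(1) orth orth' by (auto simp: orthonormal_on_def v'_def less_Suc_eq)
    qed
    ultimately have "P (Suc n)" by (auto simp: P_def)
    then show False using n(2) by fastforce
  qed
  show ?thesis
    using that[of n v] v bound[OF v] complete self[OF v(1)] by (simp add: V_def)
qed

section \<open>The mixing inequality\<close>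

lemma (in group) sum_right_translate:
  assumes "a \<in> carrier G"
  shows "(\<Sum>x\<in>carrier G. f (x \<otimes> a)) = (\<Sum>x\<in>carrier G. f x)"
  by (rule sum.reindex_bij_witness[of _ "\<lambda>x. x \<otimes> inv a" "\<lambda>x. x \<otimes> a"])
    (use assms in \<open>auto simp: m_assoc\<close>)

lemma (in group) sum_left_translate:
  assumes "a \<in> carrier G"
  shows "(\<Sum>x\<in>carrier G. f (a \<otimes> x)) = (\<Sum>x\<in>carrier G. f x)"
  by (rule sum.reindex_bij_witness[of _ "\<lambda>x. inv a \<otimes> x" "\<lambda>x. a \<otimes> x"])
    (use assms in \<open>auto simp: m_assoc[symmetric]\<close>)

text \<open>Substituting \<open>inv y \<otimes> a\<close> for \<open>y\<close> moves the summation
  variable from one factor of a convolution to the other.\<close>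

lemma (in group) sum_inverse_translate:
  assumes "a \<in> carrier G"
  shows "(\<Sum>y\<in>carrier G. f (a \<otimes> inv y) y) = (\<Sum>y\<in>carrier G. f y (inv y \<otimes> a))"
  by (rule sum.reindex_bij_witness[of _ "\<lambda>y. inv y \<otimes> a" "\<lambda>y. a \<otimes> inv y"])
    (use assms in \<open>auto simp: m_assoc inv_mult_group\<close>, simp_all add: m_assoc[symmetric])

text \<open>Replacing \<open>y\<close> by \<open>z \<otimes> y\<close> preserves the sum and fixes
  \<open>p\<close>; adding over \<open>z\<close> in \<open>K\<close> replaces \<open>f\<close> by
  its vanishing sums over \<open>K\<close>.\<close>

lemma (in group) sum_invariant_mult_mean_zero:
  fixes f p :: "'a \<Rightarrow> complex"
  assumes fin: "finite (carrier G)" and K: "K \<subseteq> carrier G" "K \<noteq> {}"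
    and f: "\<And>y. y \<in> carrier G \<Longrightarrow> (\<Sum>z\<in>K. f (z \<otimes> y)) = 0"
    and p: "\<And>z y. z \<in> K \<Longrightarrow> y \<in> carrier G \<Longrightarrow> p (z \<otimes> y) = p y"
  shows "(\<Sum>y\<in>carrier G. f y * p y) = 0"
proof -
  have "of_nat (card K) * (\<Sum>y\<in>carrier G. f y * p y) = (\<Sum>z\<in>K. \<Sum>y\<in>carrier G. f y * p y)"
    by simp
  also have "\<dots> = (\<Sum>z\<in>K. \<Sum>y\<in>carrier G. f (z \<otimes> y) * p y)"
  proof (rule sum.cong[OF refl])
    fix z assume z: "z \<in> K"
    then have "(\<Sum>y\<in>carrier G. f y * p y) = (\<Sum>y\<in>carrier G. f (z \<otimes> y) * p (z \<otimes> y))"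
      using K sum_left_translate[of z "\<lambda>y. f y * p y"] by auto
    then show "(\<Sum>y\<in>carrier G. f y * p y) = (\<Sum>y\<in>carrier G. f (z \<otimes> y) * p y)"
      using z p by simp
  qed
  also have "\<dots> = (\<Sum>y\<in>carrier G. (\<Sum>z\<in>K. f (z \<otimes> y)) * p y)"
    by (subst sum.swap) (simp add: sum_distrib_right)
  also have "\<dots> = 0" using f by simp
  finally show ?thesis using K fin finite_subset by fastforce
qed

text \<open>By \<open>invariant\<close> the span of \<open>v\<close> is stable under right
  translation, and the matrices describe it in the basis \<open>v\<close>. Translating by
  \<open>b\<close> and then by \<open>a\<close> gives \<open>g (x \<otimes> a \<otimes> b)\<close>,
  so the order of products is preserved.\<close>

lemma (in group) right_translation_representation:
  assumes v: "orthonormal_on (carrier G) n v"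
    and invariant: "\<And>a j x. \<lbrakk>a \<in> carrier G; j < n; x \<in> carrier G\<rbrakk> \<Longrightarrow>
      v j (x \<otimes> a) = proj_on (carrier G) n v (\<lambda>y. v j (y \<otimes> a)) x"
  shows "(\<lambda>a. Matrix.mat n n (\<lambda>(i, j). inner_on (carrier G) (\<lambda>x. v j (x \<otimes> a)) (v i))) \<in> hom G (GL n)"
    (is "?\<rho> \<in> _")
proof -
  have mult: "?\<rho> (a \<otimes> b) = ?\<rho> a * ?\<rho> b" if ab: "a \<in> carrier G" "b \<in> carrier G" for a b
  proof (rule eq_matI)
    fix i j assume "i < dim_row (?\<rho> a * ?\<rho> b)" "j < dim_col (?\<rho> a * ?\<rho> b)"
    then have ij: "i < n" "j < n" by auto
    have "v j (x \<otimes> (a \<otimes> b)) =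
        (\<Sum>k<n. inner_on (carrier G) (\<lambda>y. v j (y \<otimes> b)) (v k) * v k (x \<otimes> a))"
      if "x \<in> carrier G" for x
      using invariant[of b j "x \<otimes> a"] that ab ij by (simp add: m_assoc proj_on_def)
    then have "inner_on (carrier G) (\<lambda>x. v j (x \<otimes> (a \<otimes> b))) (v i) =
        inner_on (carrier G)
          (\<lambda>x. \<Sum>k<n. inner_on (carrier G) (\<lambda>y. v j (y \<otimes> b)) (v k) * v k (x \<otimes> a)) (v i)"
      by (intro inner_on_cong) auto
    also have "\<dots> = (\<Sum>k<n. inner_on (carrier G) (\<lambda>y. v j (y \<otimes> b)) (v k) *
        inner_on (carrier G) (\<lambda>x. v k (x \<otimes> a)) (v i))"
      by (simp add: inner_on_linear)
    finally show "?\<rho> (a \<otimes> b) $$ (i, j) = (?\<rho> a * ?\<rho> b) $$ (i, j)"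
      using ij by (simp add: scalar_prod_def lessThan_atLeast0 mult.commute)
  qed auto
  have one: "?\<rho> \<one> = 1\<^sub>m n"
  proof (rule eq_matI)
    fix i j assume "i < dim_row (1\<^sub>m n :: complex mat)" "j < dim_col (1\<^sub>m n :: complex mat)"
    moreover from this have "inner_on (carrier G) (\<lambda>x. v j (x \<otimes> \<one>)) (v i) = inner_on (carrier G) (v j) (v i)"
      by (intro inner_on_cong) auto
    ultimately show "?\<rho> \<one> $$ (i, j) = 1\<^sub>m n $$ (i, j)"
      using v by (auto simp: orthonormal_on_def)
  qed auto
  have "?\<rho> a \<in> Units (ring_mat TYPE(complex) n ())" if a: "a \<in> carrier G" for a
  proof -
    have "?\<rho> (inv a) * ?\<rho> a = 1\<^sub>m n" "?\<rho> a * ?\<rho> (inv a) = 1\<^sub>m n"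
      using a mult[of "inv a" a] mult[of a "inv a"] one by simp_all
    then show ?thesis
      unfolding Units_def by (auto simp: ring_mat_simps intro!: bexI[of _ "?\<rho> (inv a)"])
  qed
  then show ?thesis
    using mult by (auto simp: hom_def units_of_def ring_mat_simps)
qed

text \<open>The operator is \<open>card (carrier G)\<close> times convolution by \<open>f\<close>,
  whence the factor on the right; the last hypothesis says that \<open>f\<close> has zero average on
  every coset of \<open>K\<close>.\<close>

lemma (in group) mixing_inequality:
  fixes f g :: "'a \<Rightarrow> complex"
  assumes fin: "finite (carrier G)" and K: "K \<lhd> G"
    and D: "D \<ge> 0" "\<And>n \<rho>. \<rho> \<in> hom G (GL n) \<Longrightarrow> \<exists>z\<in>K. \<rho> z \<noteq> 1\<^sub>m n \<Longrightarrow> D \<le> real n"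
    and f: "\<And>y. y \<in> carrier G \<Longrightarrow> (\<Sum>z\<in>K. f (z \<otimes> y)) = 0"
  shows "D * sq_sum (carrier G) (kernel_op (carrier G) (\<lambda>x y. f (x \<otimes> inv y)) g)
    \<le> card (carrier G) * sq_sum (carrier G) f * sq_sum (carrier G) g"
proof -
  interpret K: normal K G by fact
  define A where "A = carrier G"
  define T where "T = kernel_op A (\<lambda>x y. f (x \<otimes> inv y))"
  have finA: "finite A" "A \<noteq> {}" using fin by (auto simp: A_def)
  obtain w where w: "sq_sum A w = 1"
    "\<And>g. sq_sum A (T g) \<le> sq_sum A (T w) * sq_sum A g"
    unfolding T_def using kernel_op_top_vector[OF finA] by metis
  define \<mu> where "\<mu> = sq_sum A (T w)"
  have le: "sq_sum A (T g) \<le> \<mu> * sq_sum A g" for g using w by (simp add: \<mu>_def)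
  \<comment> \<open>Each row of the kernel is a rearrangement of \<open>f\<close>.\<close>
  have HS: "(\<Sum>x\<in>A. sq_sum A (\<lambda>y. f (x \<otimes> inv y))) = card A * sq_sum A f"
  proof -
    have "sq_sum A (\<lambda>y. f (x \<otimes> inv y)) = sq_sum A f" if "x \<in> A" for x
      using that sum_inverse_translate[of x "\<lambda>t _. (cmod (f t))\<^sup>2"] by (simp add: sq_sum_def A_def)
    then show ?thesis by simp
  qed
  have "D * \<mu> \<le> card A * sq_sum A f"
  proof (cases "\<mu> = 0")
    case False
    then have pos: "\<mu> > 0" using sq_sum_nonneg[of A "T w"] unfolding \<mu>_def by linarith
    \<comment> \<open>The kernel depends only on \<open>x \<otimes> inv y\<close>, which is
      unchanged when both variables are multiplied on the right by \<open>a\<close>.\<close>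
    have equivariant: "T (\<lambda>y. g (y \<otimes> a)) x = T g (x \<otimes> a)" if "a \<in> A" "x \<in> A" for a x g
    proof -
      have "T g (x \<otimes> a) = (\<Sum>y\<in>A. f (x \<otimes> a \<otimes> inv (y \<otimes> a)) * g (y \<otimes> a))"
        using that sum_right_translate[of a "\<lambda>y. f (x \<otimes> a \<otimes> inv y) * g y"]
        by (simp add: T_def kernel_op_def A_def)
      also have "\<dots> = T (\<lambda>y. g (y \<otimes> a)) x"
        unfolding T_def kernel_op_def
      proof (rule sum.cong[OF refl])
        fix y assume "y \<in> A"
        then have "x \<otimes> a \<otimes> inv (y \<otimes> a) = x \<otimes> inv y"
          using that by (simp add: A_def inv_mult_group m_assoc inv_solve_left' flip: m_assoc[of a])
        then show "f (x \<otimes> a \<otimes> inv (y \<otimes> a)) * g (y \<otimes> a) = f (x \<otimes> inv y) * g (y \<otimes> a)" by simp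
      qed
      finally show ?thesis by simp
    qed
    have translate: "sq_sum A (\<lambda>x. h (x \<otimes> a)) = sq_sum A h" if "a \<in> A" for h a
      using that sum_right_translate[of a "\<lambda>x. (cmod (h x))\<^sup>2"] by (simp add: sq_sum_def A_def)
    obtain n v where v: "orthonormal_on A n v" and n: "n * \<mu> \<le> (\<Sum>x\<in>A. sq_sum A (\<lambda>y. f (x \<otimes> inv y)))"
      and top: "\<And>i. i < n \<Longrightarrow> sq_sum A (T (v i)) = \<mu>"
      and span: "\<And>w x. sq_sum A (T w) = \<mu> * sq_sum A w \<Longrightarrow> x \<in> A \<Longrightarrow> w x = proj_on A n v w x"
      using top_space_basis[OF finA(1) pos, of "\<lambda>x y. f (x \<otimes> inv y)", folded T_def] le by metis
    have v1: "sq_sum A (v j) = 1" if "j < n" for j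
    proof -
      have "inner_on A (v j) (v j) = 1" using that v by (simp add: orthonormal_on_def)
      then show ?thesis by (simp add: inner_on_self)
    qed
    \<comment> \<open>A right translate of \<open>v j\<close> keeps its norm and that of its image
      under \<open>T\<close>, so it stays in the top space.\<close>
    have expand: "v j (x \<otimes> a) = proj_on A n v (\<lambda>y. v j (y \<otimes> a)) x"
      if "a \<in> A" "j < n" "x \<in> A" for a j x
    proof (rule span[OF _ \<open>x \<in> A\<close>])
      have "sq_sum A (T (\<lambda>y. v j (y \<otimes> a))) = sq_sum A (\<lambda>x. T (v j) (x \<otimes> a))"
        by (intro sq_sum_cong equivariant that)
      then show "sq_sum A (T (\<lambda>y. v j (y \<otimes> a))) = \<mu> * sq_sum A (\<lambda>y. v j (y \<otimes> a))"
        using that top v1 by (simp add: translate)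
    qed
    define \<rho> where "\<rho> a = Matrix.mat n n (\<lambda>(i, j). inner_on A (\<lambda>x. v j (x \<otimes> a)) (v i))" for a
    have hom: "\<rho> \<in> hom G (GL n)"
      using right_translation_representation[of n v] v expand by (simp add: A_def \<rho>_def[abs_def])
    \<comment> \<open>Were \<open>\<rho>\<close> trivial on \<open>K\<close>, every
      \<open>v j\<close>, and with them the maximiser \<open>w\<close>, would be right
      \<open>K\<close>-invariant. The zero averages of \<open>f\<close> would then make
      \<open>T w\<close> vanish on \<open>A\<close>, against \<open>\<mu> > 0\<close>.\<close>
    have "\<exists>z\<in>K. \<rho> z \<noteq> 1\<^sub>m n"
    proof (rule ccontr)
      assume "\<not> (\<exists>z\<in>K. \<rho> z \<noteq> 1\<^sub>m n)"
      then have triv: "\<rho> z = 1\<^sub>m n" if "z \<in> K" for z using that by blast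
      have v_inv: "v j (x \<otimes> z) = v j x" if "z \<in> K" "j < n" "x \<in> A" for z j x
      proof -
        have "z \<in> A" using that by (simp add: A_def)
        have "inner_on A (\<lambda>y. v j (y \<otimes> z)) (v i) = (if i = j then 1 else 0)" if "i < n" for i
          using arg_cong[OF triv[OF \<open>z \<in> K\<close>], of "\<lambda>M. M $$ (i, j)"] that \<open>j < n\<close> by (simp add: \<rho>_def)
        then have "proj_on A n v (\<lambda>y. v j (y \<otimes> z)) x = (\<Sum>i<n. (if i = j then 1 else 0) * v i x)"
          unfolding proj_on_def by (intro sum.cong) auto
        also have "\<dots> = (\<Sum>i<n. if i = j then v i x else 0)" by (intro sum.cong) auto
        finally show ?thesis using expand[OF \<open>z \<in> A\<close> that(2,3)] that by simp
      qed
      have w_span: "w x = proj_on A n v w x" if "x \<in> A" for x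
        using that w(1) by (intro span) (simp_all add: \<mu>_def)
      have w_inv: "w (x \<otimes> z) = w x" if "z \<in> K" "x \<in> A" for z x
        using that w_span[of x] w_span[of "x \<otimes> z"] v_inv by (simp add: proj_on_def A_def)
      have "T w x = 0" if x: "x \<in> A" for x
      proof -
        have "T w x = (\<Sum>y\<in>carrier G. f y * w (inv y \<otimes> x))"
          using x sum_inverse_translate[of x "\<lambda>s t. f s * w t"] by (simp add: T_def kernel_op_def A_def)
        also have "\<dots> = 0"
        proof (rule sum_invariant_mult_mean_zero[OF fin K.subset _ f])
          show "K \<noteq> {}" using K.one_closed by blast
          fix z y assume zy: "z \<in> K" "y \<in> carrier G"
          let ?u = "inv y \<otimes> x"
          have u: "?u \<in> carrier G" and zG: "z \<in> carrier G" using zy x by (auto simp: A_def)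
          \<comment> \<open>By normality, left multiplication of \<open>y\<close> by
            \<open>z\<close> becomes right multiplication of \<open>inv y \<otimes> x\<close> by an
            element of \<open>K\<close>.\<close>
          have "inv x \<otimes> inv z \<otimes> x \<in> K"
            using K.inv_op_closed1[of x "inv z"] zy x by (simp add: A_def)
          moreover have "inv (z \<otimes> y) \<otimes> x = ?u \<otimes> (inv x \<otimes> inv z \<otimes> x)"
            using zy zG x by (simp add: A_def inv_mult_group m_assoc inv_solve_left' flip: m_assoc[of x])
          ultimately show "w (inv (z \<otimes> y) \<otimes> x) = w ?u"
            using w_inv[of _ ?u] u by (simp add: A_def)
        qed
        finally show ?thesis .
      qed
      then have "sq_sum A (T w) = 0" by (simp add: sq_sum_def)
      then show False using False by (simp add: \<mu>_def)
    qed
    then have "D \<le> real n" using D hom by blast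
    then have "D * \<mu> \<le> n * \<mu>" using pos by (intro mult_right_mono) auto
    then show ?thesis using n HS by linarith
  qed simp
  then have "D * \<mu> * sq_sum A g \<le> card A * sq_sum A f * sq_sum A g"
    by (intro mult_right_mono) auto
  moreover have "D * sq_sum A (T g) \<le> D * (\<mu> * sq_sum A g)"
    by (intro mult_left_mono le D)
  ultimately show ?thesis by (simp add: A_def T_def mult.assoc)
qed

section \<open>Convolutions and coset averages\<close>

lemma convolution_eq_kernel_op:
  "convolution G f g x =
    kernel_op (carrier G) (\<lambda>x y. f (x \<otimes>\<^bsub>G\<^esub> inv\<^bsub>G\<^esub> y)) g x / of_nat (card (carrier G))"
  by (simp add: convolution_def kernel_op_def)

lemma sq_sum_convolution:
  "sq_sum A (convolution G f g) =
    sq_sum A (kernel_op (carrier G) (\<lambda>x y. f (x \<otimes>\<^bsub>G\<^esub> inv\<^bsub>G\<^esub> y)) g) / (card (carrier G))\<^sup>2"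
  by (simp add: sq_sum_def convolution_eq_kernel_op norm_divide power_divide sum_divide_distrib)

lemma norm_2_eq: "(norm_2 G f)\<^sup>2 = sq_sum (carrier G) f / card (carrier G)"
  by (simp add: norm_2_def sq_sum_def sum_nonneg)

text \<open>The projection \<open>P\<close>; \<open>z\<close> multiplies on the left so that
  averaging is compatible with convolving on the right.\<close>

definition average :: "('g, 'p) monoid_scheme \<Rightarrow> 'g set \<Rightarrow> ('g \<Rightarrow> complex) \<Rightarrow> 'g \<Rightarrow> complex"
  where "average G K f x = (\<Sum>z\<in>K. f (z \<otimes>\<^bsub>G\<^esub> x)) / of_nat (card K)"

lemma (in group) average_invariant:
  assumes "subgroup K G" "z \<in> K" "x \<in> carrier G"
  shows "average G K f (z \<otimes> x) = average G K f x"
proof -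
  interpret K: subgroup K G by fact
  have "(\<Sum>u\<in>K. f (u \<otimes> (z \<otimes> x))) = (\<Sum>u\<in>K. f (u \<otimes> x))"
    by (rule sum.reindex_bij_witness[of _ "\<lambda>u. u \<otimes> inv z" "\<lambda>u. u \<otimes> z"])
      (use assms in \<open>auto simp: m_assoc\<close>)
  then show ?thesis by (simp add: average_def)
qed

lemma (in group) sum_minus_average:
  assumes "finite (carrier G)" and K: "subgroup K G" and x: "x \<in> carrier G"
  shows "(\<Sum>z\<in>K. f (z \<otimes> x) - average G K f (z \<otimes> x)) = 0"
proof -
  interpret K: subgroup K G by fact
  have "finite K" using assms(1) K.subset finite_subset by blast
  then have "card K \<noteq> 0" using K.one_closed by (metis card_0_eq empty_iff)
  then show ?thesis
    using average_invariant[OF K _ x] by (simp add: sum_subtractf) (simp add: average_def)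
qed

text \<open>Pythagoras: the average is \<open>K\<close>-invariant and the remainder has zero sums
  over \<open>K\<close>, so the two are orthogonal.\<close>

lemma (in group) sq_sum_average:
  assumes fin: "finite (carrier G)" and K: "subgroup K G"
  shows "sq_sum (carrier G) f =
    sq_sum (carrier G) (average G K f) + sq_sum (carrier G) (\<lambda>x. f x - average G K f x)"
proof -
  interpret K: subgroup K G by fact
  have "inner_on (carrier G) (\<lambda>x. f x - average G K f x) (average G K f) = 0"
    unfolding inner_on_def
  proof (rule sum_invariant_mult_mean_zero[OF fin K.subset _ sum_minus_average[OF fin K]])
    show "K \<noteq> {}" using K.one_closed by blast
  qed (simp_all add: average_invariant[OF K])
  then have "inner_on (carrier G) (average G K f) (\<lambda>x. f x - average G K f x) = 0"
    by (metis inner_on_cnj complex_cnj_zero)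
  then show ?thesis
    using sq_sum_add_scale[of "carrier G" "average G K f" 1 "\<lambda>x. f x - average G K f x"] by simp
qed

text \<open>Left translation acts on the first factor alone, by associativity of
  \<open>z \<otimes> x \<otimes> inv y\<close>; averaging the convolution thus amounts to averaging
  \<open>f\<close>.\<close>

lemma (in group) convolution_minus_average:
  assumes K: "subgroup K G" and x: "x \<in> carrier G"
  shows "convolution G f g x - average G K (convolution G f g) x =
    convolution G (\<lambda>y. f y - average G K f y) g x"
proof -
  interpret K: subgroup K G by fact
  have "(\<Sum>z\<in>K. convolution G f g (z \<otimes> x)) =
      (\<Sum>z\<in>K. \<Sum>y\<in>carrier G. f (z \<otimes> (x \<otimes> inv y)) * g y) / of_nat (card (carrier G))"
    unfolding convolution_def sum_divide_distrib using x by (simp add: m_assoc)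
  also have "(\<Sum>z\<in>K. \<Sum>y\<in>carrier G. f (z \<otimes> (x \<otimes> inv y)) * g y) =
      (\<Sum>y\<in>carrier G. (\<Sum>z\<in>K. f (z \<otimes> (x \<otimes> inv y))) * g y)"
    by (subst sum.swap) (simp add: sum_distrib_right)
  finally have "average G K (convolution G f g) x =
      (\<Sum>y\<in>carrier G. (\<Sum>z\<in>K. f (z \<otimes> (x \<otimes> inv y))) * g y) /
        of_nat (card (carrier G)) / of_nat (card K)"
    by (simp add: average_def)
  also have "\<dots> = convolution G (average G K f) g x"
    by (simp add: average_def convolution_def mult.commute flip: sum_divide_distrib)
  finally have "average G K (convolution G f g) x = convolution G (average G K f) g x" .
  then show ?thesis
    by (simp add: convolution_def algebra_simps sum_subtractf diff_divide_distrib)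
qed

text \<open>Induction at the end of the list, where the outermost convolution of
  \<open>foldl\<close> sits. Each step moves the remainder onto the earlier factors and applies the
  mixing inequality once.\<close>

lemma (in group) sq_sum_foldl_convolution_minus_average:
  fixes f :: "'a \<Rightarrow> complex"
  assumes fin: "finite (carrier G)" and K: "K \<lhd> G"
    and D: "D \<ge> 0" "\<And>n \<rho>. \<rho> \<in> hom G (GL n) \<Longrightarrow> \<exists>z\<in>K. \<rho> z \<noteq> 1\<^sub>m n \<Longrightarrow> D \<le> real n"
  defines "F \<equiv> \<lambda>fs. foldl (convolution G) f fs"
  shows "D ^ length fs * sq_sum (carrier G) (\<lambda>x. F fs x - average G K (F fs) x)
    \<le> sq_sum (carrier G) f * prod_list (map (sq_sum (carrier G)) fs) / card (carrier G) ^ length fs"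
proof (induction fs rule: rev_induct)
  \<comment> \<open>Here the claim is that removing the average does not increase the norm.\<close>
  case Nil
  have "subgroup K G" using K by (rule normal_imp_subgroup)
  then show ?case
    using sq_sum_average[OF fin, of K f] by (simp add: F_def)
next
  case (snoc g fs)
  have sub: "subgroup K G" using K by (rule normal_imp_subgroup)
  let ?S = "sq_sum (carrier G)" and ?c = "real (card (carrier G))"
  let ?f = "\<lambda>x. F fs x - average G K (F fs) x"
  have c: "?c > 0" using fin one_closed by (auto simp: card_gt_0_iff)
  have "?S (\<lambda>x. F (fs @ [g]) x - average G K (F (fs @ [g])) x) = ?S (convolution G ?f g)"
    using convolution_minus_average[OF sub] by (intro sq_sum_cong) (simp add: F_def)
  moreover have "D * ?S (convolution G ?f g) \<le> ?S ?f * ?S g / ?c"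
  proof -
    have "D * ?S (kernel_op (carrier G) (\<lambda>x y. ?f (x \<otimes> inv y)) g) \<le> ?c * ?S ?f * ?S g"
      by (rule mixing_inequality[OF fin K D sum_minus_average[OF fin sub]])
    then show ?thesis
      using c by (simp add: sq_sum_convolution field_simps power2_eq_square)
  qed
  ultimately have "D ^ length fs * (D * ?S (\<lambda>x. F (fs @ [g]) x - average G K (F (fs @ [g])) x))
      \<le> D ^ length fs * (?S ?f * ?S g / ?c)"
    using D(1) by (intro mult_left_mono) simp_all
  also have "\<dots> = (D ^ length fs * ?S ?f) * (?S g / ?c)" by simp
  also have "\<dots> \<le> (?S f * prod_list (map ?S fs) / ?c ^ length fs) * (?S g / ?c)"
    using snoc c by (intro mult_right_mono) simp_all
  finally show ?case by (simp add: algebra_simps)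
qed

section \<open>Counting products\<close>

lemma finite_listset: "(\<And>X. X \<in> set Xs \<Longrightarrow> finite X) \<Longrightarrow> finite (listset Xs)"
  by (induction Xs) (auto simp: set_Cons_def intro!: finite_image_set2)

lemma listset_subset_lists: "\<Union>(set Xs) \<subseteq> A \<Longrightarrow> listset Xs \<subseteq> lists A"
  by (induction Xs) (auto simp: set_Cons_def subset_iff in_lists_conv_set)

text \<open>\<open>listset\<close> unfolds at the head, whereas the iterated convolution unfolds at
  its last factor.\<close>

lemma listset_snoc: "listset (Xs @ [X]) = {xs @ [x] |xs x. xs \<in> listset Xs \<and> x \<in> X}"
proof (induction Xs)
  case Nil
  then show ?case by (auto simp: set_Cons_def)
next
  case (Cons Y Xs)
  show ?case
  proof (intro equalityI subsetI)
    fix ys assume "ys \<in> listset ((Y # Xs) @ [X])"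
    then obtain y xs x where "ys = (y # xs) @ [x]" "y \<in> Y" "xs \<in> listset Xs" "x \<in> X"
      using Cons.IH by (auto simp: set_Cons_def)
    then show "ys \<in> {xs @ [x] |xs x. xs \<in> listset (Y # Xs) \<and> x \<in> X}"
      unfolding set_Cons_def listset.simps by blast
  next
    fix ys assume "ys \<in> {xs @ [x] |xs x. xs \<in> listset (Y # Xs) \<and> x \<in> X}"
    then show "ys \<in> listset ((Y # Xs) @ [X])"
      using Cons.IH by (auto simp: set_Cons_def)
  qed
qed

lemma (in group) list_mult_closed: "xs \<in> lists (carrier G) \<Longrightarrow> list_mult G xs \<in> carrier G"
  by (induction xs) (auto simp: list_mult_def)

lemma (in group) list_mult_snoc:
  "xs \<in> lists (carrier G) \<Longrightarrow> x \<in> carrier G \<Longrightarrow> list_mult G (xs @ [x]) = list_mult G xs \<otimes> x"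
proof (induction xs)
  case (Cons y xs)
  then show ?case using list_mult_closed[of xs] by (auto simp: list_mult_def m_assoc)
qed (simp add: list_mult_def)

text \<open>The value at \<open>x\<close> counts its factorisations; joining the functions takes
  \<open>length Xs - 1\<close> convolutions, each dividing once by the group order.\<close>

lemma (in group) convolutions_indicator:
  assumes fin: "finite (carrier G)" and "Xs \<noteq> []"
    and "\<And>X. X \<in> set Xs \<Longrightarrow> X \<subseteq> carrier G" and "x \<in> carrier G"
  shows "convolutions G (map indicator Xs) x =
    of_nat (card {xs \<in> listset Xs. list_mult G xs = x}) / of_nat (card (carrier G)) ^ (length Xs - 1)"
  using assms(2-)
proof (induction Xs arbitrary: x rule: rev_nonempty_induct)
  case (single X)
  then have "{xs \<in> listset [X]. list_mult G xs = x} = (if x \<in> X then {[x]} else {})"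
    by (auto simp: set_Cons_def list_mult_def subset_iff)
  then show ?case by (simp add: convolutions_def)
next
  case (snoc X Xs)
  let ?c = "of_nat (card (carrier G)) :: complex"
  let ?M = "\<lambda>Xs x. {xs \<in> listset Xs. list_mult G xs = x}"
  have Xs: "X \<subseteq> carrier G" "\<And>Y. Y \<in> set Xs \<Longrightarrow> Y \<subseteq> carrier G" and x: "x \<in> carrier G"
    using snoc.prems by auto
  have finX: "finite X" using Xs fin finite_subset by blast
  have lists: "listset Xs \<subseteq> lists (carrier G)" by (intro listset_subset_lists Sup_least Xs)
  have finL: "finite (listset Xs)"
    using Xs(2) fin finite_subset by (intro finite_listset) blast
  have "?M (Xs @ [X]) x = (\<lambda>(y, xs). xs @ [y]) ` (SIGMA y:X. ?M Xs (x \<otimes> inv y))"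
  proof -
    \<comment> \<open>Once the last factor \<open>y\<close> is chosen, the others must multiply to
      \<open>x \<otimes> inv y\<close>.\<close>
    have "list_mult G (xs @ [y]) = x \<longleftrightarrow> list_mult G xs = x \<otimes> inv y"
      if "xs \<in> listset Xs" "y \<in> X" for xs y
    proof -
      have "list_mult G xs \<in> carrier G" "y \<in> carrier G"
        using that lists list_mult_closed[of xs] Xs(1) by blast+
      then show ?thesis
        using that lists x by (subst list_mult_snoc) (auto simp: m_assoc)
    qed
    then show ?thesis unfolding listset_snoc by force
  qed
  moreover have "inj_on (\<lambda>(y, xs). xs @ [y]) (SIGMA y:X. ?M Xs (x \<otimes> inv y))"
    by (auto simp: inj_on_def)
  ultimately have "card (?M (Xs @ [X]) x) = (\<Sum>y\<in>X. card (?M Xs (x \<otimes> inv y)))"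
    using finX finL by (simp add: card_image card_SigmaI)
  moreover have "convolutions G (map indicator (Xs @ [X])) x =
      (\<Sum>y\<in>X. of_nat (card (?M Xs (x \<otimes> inv y))) / ?c ^ (length Xs - 1)) / ?c"
  proof -
    have "convolutions G (map indicator (Xs @ [X])) x =
        convolution G (convolutions G (map indicator Xs)) (indicator X) x"
      using snoc.hyps by (simp add: convolutions_def)
    also have "\<dots> = (\<Sum>y\<in>carrier G. convolutions G (map indicator Xs) (x \<otimes> inv y) * indicator X y) / ?c"
      by (simp add: convolution_def)
    also have "(\<Sum>y\<in>carrier G. convolutions G (map indicator Xs) (x \<otimes> inv y) * indicator X y) =
        (\<Sum>y\<in>X. convolutions G (map indicator Xs) (x \<otimes> inv y))"
      using fin Xs(1) by (simp add: indicator_def if_distrib[of "\<lambda>t. _ * t"] sum.If_cases Int_absorb1 cong: if_cong)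
    also have "\<dots> = (\<Sum>y\<in>X. of_nat (card (?M Xs (x \<otimes> inv y))) / ?c ^ (length Xs - 1))"
      using Xs x by (intro sum.cong snoc.IH) auto
    finally show ?thesis .
  qed
  \<comment> \<open>\<open>Xs\<close> is nonempty here, so the subtraction is not truncated.\<close>
  moreover have "?c ^ length Xs = ?c ^ (length Xs - 1) * ?c"
    using snoc.hyps by (cases Xs) auto
  ultimately show ?case
    by (simp add: sum_divide_distrib)
qed

lemma sq_sum_indicator: "finite A \<Longrightarrow> X \<subseteq> A \<Longrightarrow> sq_sum A (indicator X) = card X"
proof -
  have "(cmod (indicator X x))\<^sup>2 = (if x \<in> X then 1 else 0)" for x by simp
  moreover assume "finite A" "X \<subseteq> A"
  ultimately show ?thesis by (simp add: sq_sum_def sum.If_cases Int_absorb1)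
qed

section \<open>The semidirect product, its projection to \<open>H\<close> and the counting
  term\<close>

lemma snd_list_mult_semidirect:
  "snd (list_mult (semidirect N H \<phi>) xs) = list_mult H (map snd xs)"
  by (induction xs) (auto simp: list_mult_def semidirect_def split: prod.splits)

lemma semidirect_kernel:
  assumes "group N" "group H" "\<phi> \<in> hom H (AutoGroup N)"
  shows "carrier N \<times> {\<one>\<^bsub>H\<^esub>} \<lhd> semidirect N H \<phi>"
proof -
  interpret N: group N by fact
  interpret H: group H by fact
  interpret G: group "semidirect N H \<phi>" by (rule group_semidirect) fact+
  interpret group_hom "semidirect N H \<phi>" H snd
    by unfold_locales (auto simp: hom_def)
  have "kernel (semidirect N H \<phi>) H snd = carrier N \<times> {\<one>\<^bsub>H\<^esub>}"
    by (auto simp: kernel_def)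
  then show ?thesis using normal_kernel by simp
qed

lemma semidirect_kernel_mult:
  assumes "group N" "group H" "\<phi> \<in> hom H (AutoGroup N)"
    and "z \<in> carrier N" "z' \<in> carrier N" "h \<in> carrier H"
  shows "(z', \<one>\<^bsub>H\<^esub>) \<otimes>\<^bsub>semidirect N H \<phi>\<^esub> (z, h) = (z' \<otimes>\<^bsub>N\<^esub> z, h)"
proof -
  interpret N: group N by fact
  interpret H: group H by fact
  interpret G: group "semidirect N H \<phi>" by (rule group_semidirect) fact+
  have "\<phi> \<one>\<^bsub>H\<^esub> z \<in> carrier N"
    using assms(3,4) H.one_closed by (fastforce simp: hom_def AutoGroup_def auto_def)
  \<comment> \<open>The trivial action of the identity is read off from the left unit law of the
    semidirect product.\<close>
  then have "\<phi> \<one>\<^bsub>H\<^esub> z = z"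
    using G.l_one[of "(z, h)"] assms by simp
  then show ?thesis using assms by simp
qed

text \<open>Pairs with equal images are sorted by their common image; this turns
  \<open>dot_count\<close> into a sum of squares over \<open>H\<close>.\<close>

lemma sum_card_fibres_square:
  assumes "finite L" "finite B" "f ` L \<subseteq> B"
  shows "card {(x, y). x \<in> L \<and> y \<in> L \<and> f x = f y} = (\<Sum>b\<in>B. (card {x \<in> L. f x = b})\<^sup>2)"
proof -
  have "{(x, y). x \<in> L \<and> y \<in> L \<and> f x = f y} =
      (\<Union>b\<in>B. {x \<in> L. f x = b} \<times> {x \<in> L. f x = b})"
    using assms by auto
  also have "card \<dots> = (\<Sum>b\<in>B. card ({x \<in> L. f x = b} \<times> {x \<in> L. f x = b}))"
    using assms by (intro card_UN_disjoint) auto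
  finally show ?thesis by (simp add: card_cartesian_product power2_eq_square)
qed

text \<open>A coset of \<open>N \<times> 1\<close> is a fibre of \<open>snd\<close>, so averaging
  adds the factorisation counts of all elements over one \<open>h\<close>. The average depends on
  \<open>h\<close> alone, through the number \<open>r h\<close> of tuples whose dotted product is
  \<open>h\<close>.\<close>

lemma sq_sum_average_convolutions_indicator:
  assumes N: "group N" "finite (carrier N)" and H: "group H" "finite (carrier H)"
    and \<phi>: "\<phi> \<in> hom H (AutoGroup N)" and G: "G = semidirect N H \<phi>"
    and Xs: "Xs \<noteq> []" "\<And>X. X \<in> set Xs \<Longrightarrow> X \<subseteq> carrier G"
  shows "sq_sum (carrier G) (average G (carrier N \<times> {\<one>\<^bsub>H\<^esub>}) (convolutions G (map indicator Xs)))
    = dot_count H Xs / (card (carrier N) * card (carrier G) ^ (2 * (length Xs - 1)))"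
proof -
  interpret N: group N by fact
  interpret H: group H by fact
  interpret G: group G unfolding G by (rule group_semidirect) fact+
  let ?K = "carrier N \<times> {\<one>\<^bsub>H\<^esub>}" and ?F = "convolutions G (map indicator Xs)"
  define c where "c = card (carrier G) ^ (length Xs - 1)"
  define r where "r h = card {xs \<in> listset Xs. list_mult H (map snd xs) = h}" for h
  have finG: "finite (carrier G)" using N H by (simp add: G)
  have finL: "finite (listset Xs)"
    using Xs(2) finG finite_subset by (intro finite_listset) blast
  have lists: "listset Xs \<subseteq> lists (carrier G)" by (intro listset_subset_lists Sup_least Xs)
  have "average G ?K ?F (z, h) = of_nat (r h) / of_nat (c * card (carrier N))"
    if zh: "z \<in> carrier N" "h \<in> carrier H" for z h
  proof -
    have "(\<Sum>u\<in>?K. ?F (u \<otimes>\<^bsub>G\<^esub> (z, h))) = (\<Sum>u\<in>carrier N. ?F (u \<otimes>\<^bsub>N\<^esub> z, h))"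
      using zh semidirect_kernel_mult[OF N(1) H(1) \<phi> zh(1) _ zh(2)]
      by (intro sum.reindex_bij_witness[of _ "\<lambda>u. (u, \<one>\<^bsub>H\<^esub>)" fst]) (auto simp: G)
    \<comment> \<open>Multiplication by \<open>z\<close> permutes \<open>N\<close>, so the
      dependence on \<open>z\<close> disappears.\<close>
    also have "\<dots> = (\<Sum>u\<in>carrier N. ?F (u, h))"
      using N.sum_right_translate[of z "\<lambda>u. ?F (u, h)"] zh by simp
    also have "\<dots> = (\<Sum>u\<in>carrier N. of_nat (card {xs \<in> listset Xs. list_mult G xs = (u, h)}) / of_nat c)"
      using G.convolutions_indicator[OF finG Xs] zh by (intro sum.cong) (auto simp: G c_def)
    also have "\<dots> = of_nat (\<Sum>u\<in>carrier N. card {xs \<in> listset Xs. list_mult G xs = (u, h)}) / of_nat c"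
      by (simp add: sum_divide_distrib)
    also have "(\<Sum>u\<in>carrier N. card {xs \<in> listset Xs. list_mult G xs = (u, h)}) =
        card (\<Union>u\<in>carrier N. {xs \<in> listset Xs. list_mult G xs = (u, h)})"
      using finL N by (intro card_UN_disjoint[symmetric]) auto
    \<comment> \<open>Letting \<open>u\<close> range over \<open>N\<close> leaves only the condition
      on the product of the second coordinates.\<close>
    also have "(\<Union>u\<in>carrier N. {xs \<in> listset Xs. list_mult G xs = (u, h)}) =
        {xs \<in> listset Xs. list_mult H (map snd xs) = h}"
    proof -
      have "(\<exists>u\<in>carrier N. list_mult G xs = (u, h)) \<longleftrightarrow> list_mult H (map snd xs) = h"
        if "xs \<in> listset Xs" for xs
        using G.list_mult_closed[of xs] lists that snd_list_mult_semidirect[of N H \<phi> xs]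
        by (cases "list_mult G xs") (auto simp: G)
      then show ?thesis by auto
    qed
    finally show ?thesis
      by (simp add: average_def r_def card_cartesian_product)
  qed
  then have "sq_sum (carrier G) (average G ?K ?F) =
      (\<Sum>z\<in>carrier N. \<Sum>h\<in>carrier H. (cmod (of_nat (r h) / of_nat (c * card (carrier N))))\<^sup>2)"
    unfolding sq_sum_def G carrier_semidirect sum.cartesian_product
    by (intro sum.cong refl) (auto simp: G)
  also have "\<dots> = card (carrier N) * (\<Sum>h\<in>carrier H. (real (r h) / real (c * card (carrier N)))\<^sup>2)"
    by (simp add: norm_divide norm_mult)
  also have "\<dots> = (\<Sum>h\<in>carrier H. (real (r h))\<^sup>2) / (card (carrier N) * c\<^sup>2)"
    by (simp add: power_divide sum_divide_distrib[symmetric] power2_eq_square)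
  also have "(\<Sum>h\<in>carrier H. (real (r h))\<^sup>2) = dot_count H Xs"
  proof -
    have "list_mult H (map snd xs) \<in> carrier H" if "xs \<in> listset Xs" for xs
    proof -
      have "xs \<in> lists (carrier G)" using lists that by blast
      then show ?thesis by (intro H.list_mult_closed) (fastforce simp: G in_lists_conv_set)
    qed
    then show ?thesis
      unfolding dot_count_def r_def using finL H by (subst sum_card_fibres_square) auto
  qed
  also have "c\<^sup>2 = card (carrier G) ^ (2 * (length Xs - 1))"
    by (simp add: c_def power_mult[symmetric] mult.commute)
  finally show ?thesis by simp
qed

theorem theorem3:
  fixes N :: "('n, 'p) monoid_scheme" and H :: "('h, 'q) monoid_scheme"
    and \<phi> :: "'h \<Rightarrow> 'n \<Rightarrow> 'n" and G :: "('n \<times> 'h) monoid"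
    and D :: real and k :: nat and Xs :: "('n \<times> 'h) set list"
  assumes "group N" and "finite (carrier N)"
    and "group H" and "finite (carrier H)"
    and "\<phi> \<in> hom H (AutoGroup N)"
    and "G = semidirect N H \<phi>"
    and "D > 0" and "quasirandom_on D N H \<phi>"
    and "k \<ge> 2" and "length Xs = k" and "\<And>X. X \<in> set Xs \<Longrightarrow> X \<subseteq> carrier G"
  shows "real (card (carrier H)) * real (dot_count H Xs) / real (card (carrier G)) ^ (2 * k)
           \<le> (norm_2 G (convolutions G (map indicator Xs)))\<^sup>2 \<and>
         (norm_2 G (convolutions G (map indicator Xs)))\<^sup>2
           \<le> real (card (carrier H)) * real (dot_count H Xs) / real (card (carrier G)) ^ (2 * k)
             + real (prod_list (map card Xs)) / (D ^ (k - 1) * real (card (carrier G)) ^ k)"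
proof -
  interpret N: group N by fact
  interpret H: group H by fact
  interpret G: group G unfolding assms(6) by (rule group_semidirect) fact+
  let ?K = "carrier N \<times> {\<one>\<^bsub>H\<^esub>}" and ?F = "convolutions G (map indicator Xs)"
    and ?S = "sq_sum (carrier G)"
  define a b where "a = real (card (carrier N))" and "b = real (card (carrier H))"
  have finG: "finite (carrier G)" using assms by simp
  have K: "?K \<lhd> G" unfolding assms(6) by (intro semidirect_kernel assms)
  have pos: "a > 0" "b > 0"
    using assms(2,4) N.one_closed H.one_closed by (auto simp: a_def b_def card_gt_0_iff)
  have c: "real (card (carrier G)) = a * b"
    by (simp add: assms(6) a_def b_def card_cartesian_product)
  \<comment> \<open>Type II means nontrivial on \<open>?K\<close>.\<close>
  have quasirandom: "D \<le> real n" if "\<rho> \<in> hom G (GL n)" "\<exists>z\<in>?K. \<rho> z \<noteq> 1\<^sub>m n" for n \<rho>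
    using assms(6,8) that by (auto simp: quasirandom_on_def complex_representation_def type_II_def)
  obtain X Xs' where Xs: "Xs = X # Xs'" using assms(9,10) by (cases Xs) auto
  obtain m where k: "k = Suc m" and m: "length Xs' = m" using assms(10) Xs by auto
  \<comment> \<open>The first summand is the counting term; the second is nonnegative, which gives
    the lower bound, and its estimate gives the upper one.\<close>
  have split: "?S ?F = ?S (average G ?K ?F) + ?S (\<lambda>x. ?F x - average G ?K ?F x)"
    by (intro G.sq_sum_average finG normal_imp_subgroup K)
  \<comment> \<open>The factor \<open>card (carrier H)\<close> arises from
    \<open>1 / (a * (a * b)) = b / (a * b) ^ 2\<close>.\<close>
  have main: "?S (average G ?K ?F) / (a * b) = b * dot_count H Xs / (a * b) ^ (2 * k)"
  proof -
    have "?S (average G ?K ?F) = dot_count H Xs / (a * (a * b) ^ (2 * m))"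
      using sq_sum_average_convolutions_indicator[OF assms(1-6), of Xs] assms(11) c Xs m
      by (simp add: a_def)
    then show ?thesis using pos by (simp add: k field_simps power2_eq_square)
  qed
  have S_indicator: "?S (indicator Y) = card Y" if "Y \<in> set Xs" for Y
    using that assms(11) finG by (intro sq_sum_indicator)
  \<comment> \<open>The first set is the initial function and the other \<open>m = k - 1\<close>
    sets form the list, so the gain is \<open>D ^ (k - 1)\<close>.\<close>
  have "D ^ m * ?S (\<lambda>x. ?F x - average G ?K ?F x) \<le>
      ?S (indicator X) * prod_list (map ?S (map indicator Xs')) / (a * b) ^ m"
    using G.sq_sum_foldl_convolution_minus_average[OF finG K less_imp_le[OF assms(7)] quasirandom,
        where f = "indicator X" and fs = "map indicator Xs'"] c
    by (simp add: Xs m convolutions_def)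
  also have "prod_list (map ?S (map indicator Xs')) = prod_list (map (\<lambda>Y. real (card Y)) Xs')"
    using S_indicator by (intro arg_cong[of _ _ prod_list]) (simp add: Xs)
  also have "\<dots> = real (prod_list (map card Xs'))"
    by (induction Xs') auto
  also have "?S (indicator X) = card X" using S_indicator Xs by simp
  finally have "D ^ m * ?S (\<lambda>x. ?F x - average G ?K ?F x) \<le> prod_list (map card Xs) / (a * b) ^ m"
    by (simp add: Xs)
  then have "?S (\<lambda>x. ?F x - average G ?K ?F x) / (a * b) \<le>
      prod_list (map card Xs) / (D ^ (k - 1) * (a * b) ^ k)"
    using pos assms(7) by (simp add: k field_simps)
  moreover have "?S (\<lambda>x. ?F x - average G ?K ?F x) / (a * b) \<ge> 0" using pos by simp
  moreover have "(norm_2 G ?F)\<^sup>2 = ?S (average G ?K ?F) / (a * b) + ?S (\<lambda>x. ?F x - average G ?K ?F x) / (a * b)"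
    by (simp add: norm_2_eq c split add_divide_distrib)
  ultimately show ?thesis
    unfolding main c b_def[symmetric] by linarith
qed

end
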